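(* For $n\ge 2$ let $s_n=|S_n(132,312)|$ be the number of permutations of $\{1,\dots,n\}$ that simultaneously avoid the contiguous patterns $132$ and $312$, and for $1\le i,j\le n$ let $s(n;i,j)$ be the number of those permutations $\pi=\pi_1\cdots\pi_n$ with $\pi_1=i$ and $\pi_2=j$. Then $s_n=\sum_{i,j=1}^n s(n;i,j)$, where the numbers $s(n;i,j)$ satisfy: - $s(n;i,i)=0$ for all $n\ge 2$ and $1\le i\le n$; - for $n\ge 3$ and $1\le j<i\le n$, $\displaystyle s(n;i,j)=\sum_{k=1}^{j-1}s(n-1;j,k)+\sum_{k=i}^{n-1}s(n-1;j,k)$; - for $n\ge 3$ and $1\le i<j\le n$, $\displaystyle s(n;i,j)=\sum_{k=1}^{i-1}s(n-1;j-1,k)+\sum_{k=j}^{n-1}s(n-1;j-1,k)$; - $s(2;1,2)=s(2;2,1)=1$ and $s(2;1,1)=s(2;2,2)=0$.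
   Context: Permutations of $\{1,\dots,n\}$ are written as words $\pi=\pi_1\pi_2\cdots\pi_n$. A pattern with no dashes, such as $132$ or $312$, is a contiguous pattern: $\pi$ contains it if some three consecutive letters $\pi_a\pi_{a+1}\pi_{a+2}$ are order-isomorphic to it, and $\pi$ avoids it otherwise. $S_n(132,312)$ is the set of permutations of $\{1,\dots,n\}$ avoiding both contiguous patterns. Empty sums are $0$. *)

theory Defs
  imports "HOL-Combinatorics.Multiset_Permutations" "HOL-Library.Sublist"
begin

definition order_isomorphic :: "nat list \<Rightarrow> nat list \<Rightarrow> bool" where
  "order_isomorphic xs ys \<longleftrightarrow> length xs = length ys \<and>
     (\<forall>a < length xs. \<forall>b < length xs. xs ! a < xs ! b \<longleftrightarrow> ys ! a < ys ! b)"

text \<open>\<^const>\<open>sublist\<close> is the contiguous notion (a factor of the word), as opposed to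
  \<^const>\<open>subseq\<close>.\<close>

definition contains_contiguous :: "nat list \<Rightarrow> nat list \<Rightarrow> bool" where
  "contains_contiguous \<pi> p \<longleftrightarrow> (\<exists>w. sublist w \<pi> \<and> order_isomorphic w p)"

definition avoiders :: "nat \<Rightarrow> nat list set \<Rightarrow> nat list set" where
  "avoiders n P = {\<pi> \<in> permutations_of_set {1..n}. \<forall>p\<in>P. \<not> contains_contiguous \<pi> p}"

definition s_total :: "nat \<Rightarrow> nat" where
  "s_total n = card (avoiders n {[1,3,2], [3,1,2]})"

text \<open>List positions start at 0, so \<open>\<pi> ! 0\<close> and \<open>\<pi> ! 1\<close> are the first two letters;
  only meaningful for \<open>n \<ge> 2\<close>.\<close>

definition s_first2 :: "nat \<Rightarrow> nat \<Rightarrow> nat \<Rightarrow> nat" where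
  "s_first2 n i j = card {\<pi> \<in> avoiders n {[1,3,2], [3,1,2]}. \<pi> ! 0 = i \<and> \<pi> ! 1 = j}"

end

theory Submission imports Defs begin

text \<open>A permutation avoids both $132$ and $312$ exactly when no letter lies strictly between the
  two letters preceding it: both patterns say that the third letter is the middle one. This
  condition only compares letters, so it survives any strictly increasing relabelling.

  Deleting the first letter $i$ and closing the gap in the alphabet is therefore a bijection from
  the avoiders of $\{1,\dots,n\}$ that start with $i$ onto those avoiders of
  $\{1,\dots,n-1\}$ whose first two letters, once the gap is reopened, satisfy the condition
  together with $i$ (\<open>avoiders_starting_with\<close>). Fixing the second letter $j$ of the original
  fixes the first letter of the shorter permutation, which is $j$ or $j-1$ according as $j < i$ or
  $j > i$. Its second letter $k$ must differ from that first letter and must not reopen to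
  something strictly between $i$ and $j$; the values left over form an initial and a final
  segment of $\{1,\dots,n-1\}$, whence the two sums in the recurrences.\<close>

section \<open>Avoidance as a betweenness condition\<close>

definition strictly_between :: "nat \<Rightarrow> nat \<Rightarrow> nat \<Rightarrow> bool" where
  "strictly_between a b c \<longleftrightarrow> a < c \<and> c < b \<or> b < c \<and> c < a"

fun third_never_middle :: "nat list \<Rightarrow> bool" where
  "third_never_middle (a # b # c # xs) \<longleftrightarrow>
     \<not> strictly_between a b c \<and> third_never_middle (b # c # xs)"
| "third_never_middle _ \<longleftrightarrow> True"

lemma order_isomorphic_132: "order_isomorphic [a, b, c] [1,3,2] \<longleftrightarrow> a < c \<and> c < b"
  unfolding order_isomorphic_def by (auto simp: All_less_Suc numeral_3_eq_3 numeral_2_eq_2)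

lemma order_isomorphic_312: "order_isomorphic [a, b, c] [3,1,2] \<longleftrightarrow> b < c \<and> c < a"
  unfolding order_isomorphic_def by (auto simp: All_less_Suc numeral_3_eq_3 numeral_2_eq_2)

lemma not_contains_contiguous_short:
  assumes "length xs < length p"
  shows "\<not> contains_contiguous xs p"
  using assms sublist_length_le by (fastforce simp: contains_contiguous_def order_isomorphic_def)

text \<open>A factor that does not start at the first letter is a factor of the tail, and the only
  prefix of length three is $abc$. This matches the recursion of \<open>third_never_middle\<close>.\<close>

lemma contains_contiguous_Cons3:
  assumes "length p = 3"
  shows "contains_contiguous (a # b # c # xs) p \<longleftrightarrow>
           order_isomorphic [a, b, c] p \<or> contains_contiguous (b # c # xs) p"
proof -
  have "prefix w (a # b # c # xs) \<longleftrightarrow> w = [a, b, c]" if "length w = 3" for w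
    using that by (auto simp: numeral_3_eq_3 length_Suc_conv)
  moreover have "length w = 3" if "order_isomorphic w p" for w
    using that assms by (simp add: order_isomorphic_def)
  ultimately show ?thesis
    unfolding contains_contiguous_def sublist_Cons_right[of _ a] by blast
qed

lemma third_never_middle_iff_avoids:
  "third_never_middle xs \<longleftrightarrow> (\<forall>p\<in>{[1,3,2], [3,1,2]}. \<not> contains_contiguous xs p)"
proof (induction xs rule: third_never_middle.induct)
  case (1 a b c xs)
  then show ?case
    using order_isomorphic_132[of a b c] order_isomorphic_312[of a b c]
    by (auto simp: contains_contiguous_Cons3 strictly_between_def)
qed (auto simp: not_contains_contiguous_short)

definition avoiding_perms :: "nat \<Rightarrow> nat list set" where
  "avoiding_perms n = {\<pi> \<in> permutations_of_set {1..n}. third_never_middle \<pi>}"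

lemma avoiders_eq_avoiding_perms: "avoiders n {[1,3,2], [3,1,2]} = avoiding_perms n"
  unfolding avoiders_def avoiding_perms_def third_never_middle_iff_avoids ..

lemma s_total_eq_card: "s_total n = card (avoiding_perms n)"
  unfolding s_total_def avoiders_eq_avoiding_perms ..

lemma s_first2_eq_card: "s_first2 n i j = card {\<pi> \<in> avoiding_perms n. \<pi> ! 0 = i \<and> \<pi> ! 1 = j}"
  unfolding s_first2_def avoiders_eq_avoiding_perms ..

lemma third_never_middle_map:
  assumes "strict_mono f"
  shows "third_never_middle (map f xs) \<longleftrightarrow> third_never_middle xs"
  by (induction xs rule: third_never_middle.induct)
     (simp_all add: strictly_between_def strict_mono_less[OF assms])

section \<open>Deleting the first letter\<close>

text \<open>The increasing enumeration of the alphabet with $i$ removed, which undoes the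
  standardisation performed after the first letter is deleted.\<close>

definition skip :: "nat \<Rightarrow> nat \<Rightarrow> nat" where
  "skip i x = (if x < i then x else Suc x)"

lemma strict_mono_skip: "strict_mono (skip i)"
  by (auto simp: strict_mono_def skip_def)

lemma skip_image:
  assumes "1 \<le> i" "i \<le> n"
  shows "skip i ` {1..n-1} = {1..n} - {i}"
proof
  show "skip i ` {1..n-1} \<subseteq> {1..n} - {i}"
    using assms by (auto simp: skip_def)
  show "{1..n} - {i} \<subseteq> skip i ` {1..n-1}"
  proof
    fix y assume y: "y \<in> {1..n} - {i}"
    show "y \<in> skip i ` {1..n-1}"
    proof (cases "y < i")
      case True
      then show ?thesis
        using y assms by (intro image_eqI[of _ _ y]) (auto simp: skip_def)
    next
      case False
      then show ?thesis
        using y assms by (intro image_eqI[of _ _ "y - 1"]) (auto simp: skip_def)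
    qed
  qed
qed

lemma permutations_starting_with:
  assumes "1 \<le> i" "i \<le> n"
  shows "{\<pi> \<in> permutations_of_set {1..n}. \<pi> ! 0 = i} =
           (\<lambda>\<sigma>. i # map (skip i) \<sigma>) ` permutations_of_set {1..n-1}"
proof -
  have "{\<pi> \<in> permutations_of_set {1..n}. \<pi> ! 0 = i} =
          (#) i ` permutations_of_set ({1..n} - {i})"
    using assms by (subst permutations_of_set_nonempty) auto
  also have "permutations_of_set ({1..n} - {i}) = map (skip i) ` permutations_of_set {1..n-1}"
    unfolding skip_image[OF assms, symmetric]
    by (intro permutations_of_set_image_inj inj_on_subset[OF strict_mono_imp_inj_on])
       (auto intro: strict_mono_skip)
  finally show ?thesis by (simp add: image_image)
qed

lemma third_never_middle_Cons:
  assumes "length xs \<ge> 2"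
  shows "third_never_middle (a # xs) \<longleftrightarrow>
           \<not> strictly_between a (xs ! 0) (xs ! 1) \<and> third_never_middle xs"
  using assms by (cases "a # xs" rule: third_never_middle.cases) auto

lemma length_avoiding_perm: "\<pi> \<in> avoiding_perms n \<Longrightarrow> length \<pi> = n"
  by (auto simp: avoiding_perms_def dest: length_finite_permutations_of_set)

lemma finite_avoiding_perms: "finite (avoiding_perms n)"
  by (simp add: avoiding_perms_def)

text \<open>Putting $i$ in front creates just one new triple of consecutive letters: $i$ followed by the
  first two letters of the shorter word, which exist because $n - 1 \<ge> 2$.\<close>

lemma avoiders_starting_with:
  assumes "n \<ge> 3" "1 \<le> i" "i \<le> n"
  shows "{\<pi> \<in> avoiding_perms n. \<pi> ! 0 = i} =
           (\<lambda>\<sigma>. i # map (skip i) \<sigma>) `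
             {\<sigma> \<in> avoiding_perms (n-1). \<not> strictly_between i (skip i (\<sigma> ! 0)) (skip i (\<sigma> ! 1))}"
    (is "_ = ?ins ` ?R")
proof -
  have ins: "third_never_middle (?ins \<sigma>) \<longleftrightarrow>
      \<not> strictly_between i (skip i (\<sigma> ! 0)) (skip i (\<sigma> ! 1)) \<and> third_never_middle \<sigma>"
    if "\<sigma> \<in> permutations_of_set {1..n-1}" for \<sigma>
  proof -
    have "length \<sigma> \<ge> 2"
      using that assms(1) by (simp add: length_finite_permutations_of_set)
    moreover from this have "\<sigma> \<noteq> []" by auto
    ultimately show ?thesis
      by (simp add: third_never_middle_Cons third_never_middle_map strict_mono_skip nth_map)
  qed
  have "{\<pi> \<in> avoiding_perms n. \<pi> ! 0 = i} =
          {\<pi> \<in> {\<pi> \<in> permutations_of_set {1..n}. \<pi> ! 0 = i}. third_never_middle \<pi>}"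
    by (auto simp: avoiding_perms_def)
  also have "\<dots> = ?ins ` {\<sigma> \<in> permutations_of_set {1..n-1}. third_never_middle (?ins \<sigma>)}"
    unfolding permutations_starting_with[OF assms(2,3)] by blast
  also have "{\<sigma> \<in> permutations_of_set {1..n-1}. third_never_middle (?ins \<sigma>)} = ?R"
    using ins by (auto simp: avoiding_perms_def)
  finally show ?thesis .
qed

section \<open>Counting by the first two letters\<close>

lemma first_letters_of_avoiding_perm:
  assumes "\<pi> \<in> avoiding_perms n" "n \<ge> 2"
  shows "\<pi> ! 0 \<in> {1..n}" "\<pi> ! 1 \<in> {1..n}" "\<pi> ! 0 \<noteq> \<pi> ! 1"
proof -
  have "length \<pi> = n" using assms(1) by (rule length_avoiding_perm)
  moreover have "set \<pi> = {1..n}" "distinct \<pi>"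
    using assms(1) by (auto simp: avoiding_perms_def dest: permutations_of_setD)
  ultimately show "\<pi> ! 0 \<in> {1..n}" "\<pi> ! 1 \<in> {1..n}" "\<pi> ! 0 \<noteq> \<pi> ! 1"
    using assms(2) nth_mem[of 0 \<pi>] nth_mem[of 1 \<pi>] by (auto simp: nth_eq_iff_index_eq)
qed

lemma card_by_value:
  assumes "finite A" "finite K"
  shows "card {x \<in> A. f x \<in> K} = (\<Sum>k\<in>K. card {x \<in> A. f x = k})"
proof -
  have "{x \<in> A. f x \<in> K} = (\<Union>k\<in>K. {x \<in> A. f x = k})" by blast
  moreover have "card (\<Union>k\<in>K. {x \<in> A. f x = k}) = (\<Sum>k\<in>K. card {x \<in> A. f x = k})"
    using assms by (intro card_UN_disjoint) auto
  ultimately show ?thesis by simp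
qed

lemma s_total_eq_sum:
  assumes "n \<ge> 2"
  shows "s_total n = (\<Sum>i=1..n. \<Sum>j=1..n. s_first2 n i j)"
proof -
  have "avoiding_perms n = {\<pi> \<in> avoiding_perms n. (\<pi> ! 0, \<pi> ! 1) \<in> {1..n} \<times> {1..n}}"
    using first_letters_of_avoiding_perm[OF _ assms] by auto
  then have "s_total n = (\<Sum>(i, j)\<in>{1..n} \<times> {1..n}. s_first2 n i j)"
    unfolding s_total_eq_card s_first2_eq_card
    using card_by_value[OF finite_avoiding_perms, of "{1..n} \<times> {1..n}" n "\<lambda>\<pi>. (\<pi> ! 0, \<pi> ! 1)"]
    by (simp add: case_prod_beta prod_eq_iff)
  then show ?thesis by (simp add: sum.cartesian_product)
qed

lemma s_first2_diag:
  assumes "n \<ge> 2"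
  shows "s_first2 n i i = 0"
proof -
  have "\<not> (\<pi> ! 0 = i \<and> \<pi> ! 1 = i)" if "\<pi> \<in> avoiding_perms n" for \<pi>
    using first_letters_of_avoiding_perm(3)[OF that assms] by simp
  then have "{\<pi> \<in> avoiding_perms n. \<pi> ! 0 = i \<and> \<pi> ! 1 = i} = {}"
    by (simp only: Collect_empty_eq) fast
  then show ?thesis by (simp only: s_first2_eq_card card.empty)
qed

text \<open>Both recurrences in one: $j'$ is the first letter that remains after deleting $i$ and
  standardising, and $K$ collects the admissible second letters. The hypothesis on $K$ leaves
  $j'$ itself undetermined because no permutation repeats a letter; this matters since the
  $K$ used below does not contain $j'$, although $j'$ reopens to $j$, which is not
  strictly between $i$ and $j$.\<close>

lemma s_first2_delete_first:
  assumes n: "n \<ge> 3" and i: "1 \<le> i" "i \<le> n" and j: "skip i j' = j" and K: "finite K"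
    and adm: "\<And>k. k \<in> {1..n-1} \<Longrightarrow> k \<noteq> j' \<Longrightarrow> k \<in> K \<longleftrightarrow> \<not> strictly_between i j (skip i k)"
  shows "s_first2 n i j = (\<Sum>k\<in>K. s_first2 (n-1) j' k)"
proof -
  let ?ins = "\<lambda>\<sigma>. i # map (skip i) \<sigma>"
  let ?A = "{\<sigma> \<in> avoiding_perms (n-1). \<sigma> ! 0 = j'}"
  have inj: "inj (skip i)"
    by (rule strict_mono_imp_inj_on[OF strict_mono_skip])
  have second: "?ins \<sigma> ! 1 = j \<longleftrightarrow> \<sigma> ! 0 = j'" if "\<sigma> \<in> avoiding_perms (n-1)" for \<sigma>
  proof -
    have "?ins \<sigma> ! 1 = skip i (\<sigma> ! 0)"
      using length_avoiding_perm[OF that] n by (simp add: nth_map)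
    then show ?thesis
      using inj j by (metis injD)
  qed
  have "{\<pi> \<in> avoiding_perms n. \<pi> ! 0 = i \<and> \<pi> ! 1 = j} =
          {\<pi> \<in> {\<pi> \<in> avoiding_perms n. \<pi> ! 0 = i}. \<pi> ! 1 = j}"
    by blast
  also have "\<dots> = ?ins ` {\<sigma> \<in> ?A. \<not> strictly_between i j (skip i (\<sigma> ! 1))}"
  proof -
    let ?R = "{\<sigma> \<in> avoiding_perms (n-1).
                 \<not> strictly_between i (skip i (\<sigma> ! 0)) (skip i (\<sigma> ! 1))}"
    have "{\<pi> \<in> ?ins ` ?R. \<pi> ! 1 = j} = ?ins ` {\<sigma> \<in> ?R. ?ins \<sigma> ! 1 = j}"
      by blast
    also have "{\<sigma> \<in> ?R. ?ins \<sigma> ! 1 = j} =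
                 {\<sigma> \<in> ?A. \<not> strictly_between i j (skip i (\<sigma> ! 1))}"
    proof (intro Collect_cong)
      fix \<sigma>
      show "\<sigma> \<in> ?R \<and> ?ins \<sigma> ! 1 = j \<longleftrightarrow>
              \<sigma> \<in> ?A \<and> \<not> strictly_between i j (skip i (\<sigma> ! 1))"
        using second[of \<sigma>] j by (cases "\<sigma> ! 0 = j'") auto
    qed
    finally show ?thesis
      unfolding avoiders_starting_with[OF n i] .
  qed
  also have "{\<sigma> \<in> ?A. \<not> strictly_between i j (skip i (\<sigma> ! 1))} = {\<sigma> \<in> ?A. \<sigma> ! 1 \<in> K}"
  proof (intro Collect_cong conj_cong refl)
    fix \<sigma> assume "\<sigma> \<in> ?A"
    moreover have "n - 1 \<ge> 2" using n by simp
    ultimately have "\<sigma> ! 1 \<in> {1..n-1}" "\<sigma> ! 1 \<noteq> j'"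
      using first_letters_of_avoiding_perm[of \<sigma> "n-1"] by auto
    then show "\<not> strictly_between i j (skip i (\<sigma> ! 1)) \<longleftrightarrow> \<sigma> ! 1 \<in> K"
      using adm by blast
  qed
  finally have "s_first2 n i j = card (?ins ` {\<sigma> \<in> ?A. \<sigma> ! 1 \<in> K})"
    by (simp add: s_first2_eq_card)
  also have "\<dots> = card {\<sigma> \<in> ?A. \<sigma> ! 1 \<in> K}"
    using inj by (intro card_image inj_onI) (simp add: inj_map_eq_map)
  also have "\<dots> = (\<Sum>k\<in>K. card {\<sigma> \<in> ?A. \<sigma> ! 1 = k})"
    using K by (intro card_by_value) (simp_all add: finite_avoiding_perms)
  finally show ?thesis by (simp add: s_first2_eq_card conj_assoc)
qed

lemma s_first2_descent:
  assumes "n \<ge> 3" "1 \<le> j" "j < i" "i \<le> n"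
  shows "s_first2 n i j = (\<Sum>k=1..j-1. s_first2 (n-1) j k) + (\<Sum>k=i..n-1. s_first2 (n-1) j k)"
proof -
  have "s_first2 n i j = (\<Sum>k\<in>{1..j-1} \<union> {i..n-1}. s_first2 (n-1) j k)"
    using assms by (intro s_first2_delete_first) (auto simp: skip_def strictly_between_def)
  then show ?thesis
    using assms by (subst (asm) sum.union_disjoint) auto
qed

lemma s_first2_ascent:
  assumes "n \<ge> 3" "1 \<le> i" "i < j" "j \<le> n"
  shows "s_first2 n i j =
           (\<Sum>k=1..i-1. s_first2 (n-1) (j-1) k) + (\<Sum>k=j..n-1. s_first2 (n-1) (j-1) k)"
proof -
  have "s_first2 n i j = (\<Sum>k\<in>{1..i-1} \<union> {j..n-1}. s_first2 (n-1) (j-1) k)"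
    using assms by (intro s_first2_delete_first) (auto simp: skip_def strictly_between_def)
  then show ?thesis
    using assms by (subst (asm) sum.union_disjoint) auto
qed

lemma avoiding_perms_2: "avoiding_perms 2 = {[1,2], [2,1]}"
proof -
  have "{1..2::nat} = {1, 2}"
    by (rule set_eqI) (simp only: atLeastAtMost_iff insert_iff empty_iff, arith)
  then have perms: "permutations_of_set {1..2::nat} = {[1,2], [2,1]}"
    by (simp only:) (rule permutations_of_set_doubleton, simp)
  have "\<forall>\<pi>\<in>permutations_of_set {1..2}. third_never_middle \<pi>"
    unfolding perms by simp
  then have "avoiding_perms 2 = permutations_of_set {1..2}"
    unfolding avoiding_perms_def by blast
  with perms show ?thesis by (simp only:)
qed

lemma s_first2_2: "s_first2 2 1 2 = 1" "s_first2 2 2 1 = 1"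
proof -
  have "{\<pi> \<in> avoiding_perms 2. \<pi> ! 0 = 1 \<and> \<pi> ! 1 = 2} = {[1,2]}"
       "{\<pi> \<in> avoiding_perms 2. \<pi> ! 0 = 2 \<and> \<pi> ! 1 = 1} = {[2,1]}"
    unfolding avoiding_perms_2 by auto
  then show "s_first2 2 1 2 = 1" "s_first2 2 2 1 = 1"
    by (simp_all add: s_first2_eq_card)
qed

theorem proposition3:
  "(\<forall>n\<ge>2. s_total n = (\<Sum>i=1..n. \<Sum>j=1..n. s_first2 n i j)) \<and>
   (\<forall>n\<ge>2. \<forall>i\<in>{1..n}. s_first2 n i i = 0) \<and>
   (\<forall>n\<ge>3. \<forall>i j. 1 \<le> j \<and> j < i \<and> i \<le> n \<longrightarrow>
      s_first2 n i j = (\<Sum>k=1..j-1. s_first2 (n-1) j k) + (\<Sum>k=i..n-1. s_first2 (n-1) j k)) \<and>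
   (\<forall>n\<ge>3. \<forall>i j. 1 \<le> i \<and> i < j \<and> j \<le> n \<longrightarrow>
      s_first2 n i j = (\<Sum>k=1..i-1. s_first2 (n-1) (j-1) k) + (\<Sum>k=j..n-1. s_first2 (n-1) (j-1) k)) \<and>
   s_first2 2 1 2 = 1 \<and> s_first2 2 2 1 = 1 \<and> s_first2 2 1 1 = 0 \<and> s_first2 2 2 2 = 0"
  by (intro conjI allI ballI impI; (elim conjE)?)
     (rule s_total_eq_sum s_first2_diag s_first2_descent s_first2_ascent s_first2_2; simp)+

end
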